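(* Let $H'=H|_{\mathscr{H}\times\mathscr{H}}$ be the restriction to $\mathscr{H}$ of the Hausdorff metric $H$ on $\mathscr{H}(X)$. Then the product Hausdorff metric $H_0$ is equivalent to $H'$. In particular, $$\frac{1}{\sqrt{m}}H_0(A,B)\leq H'(A,B)\leq H_0(A,B)\quad\text{for all } A,B\in\mathscr{H}.$$
   Context: Let $(X_k,d_k)$, $k=1,\dots,m$, be complete metric spaces, $X=\prod_{k=1}^m X_k$, with product metric $d_0(\vec{x},\vec{y})=\left(\sum_{k=1}^m d_k(x_k,y_k)^2\right)^{1/2}$. For a metric space $(Y,d)$, $\mathscr{H}(Y)$ is the collection of all nonempty compact subsets of $Y$; for $\delta>0$, $A_\delta=\{y\in Y: d(y,a)\le\delta\text{ for some }a\in A\}$; the Hausdorff metric is $h(A,B)=\inf\{\delta: A\subset B_\delta\text{ and }B\subset A_\delta\}$. Let $H_k$ denote the Hausdorff metric on $\mathscr{H}(X_k)$ (with respect to $d_k$) and $H$ the Hausdorff metric on $\mathscr{H}(X)$ (with respect to $d_0$). Put $\mathscr{H}=\{A_1\times\cdots\times A_m: A_k\in\mathscr{H}(X_k),\ k=1,\dots,m\}$, regarded as a subset of $\mathscr{H}(X)$. The product Hausdorff metric on $\mathscr{H}$ is $H_0(A,B)=\left(\sum_{k=1}^m H_k(A_k,B_k)^2\right)^{1/2}$ for $A=\prod_{k=1}^m A_k$, $B=\prod_{k=1}^m B_k$ in $\mathscr{H}$. *)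

theory Defs
  imports "HOL-Analysis.Analysis"
begin

text \<open>
  A finite family of metric spaces is given by carriers \<open>X k\<close> and distance functions \<open>d k\<close>,
  \<open>k \<in> {1..m}\<close>, inside one ambient type \<open>'a\<close>; points of the product are extensional functions
  in \<open>\<Pi>\<^sub>E k\<in>{1..m}. X k\<close>.
\<close>

definition nonempty_compacts :: "'a set \<Rightarrow> ('a \<Rightarrow> 'a \<Rightarrow> real) \<Rightarrow> 'a set set" where
  "nonempty_compacts Y d = {A. A \<noteq> {} \<and> compactin (Metric_space.mtopology Y d) A}"

definition thickening :: "'a set \<Rightarrow> ('a \<Rightarrow> 'a \<Rightarrow> real) \<Rightarrow> real \<Rightarrow> 'a set \<Rightarrow> 'a set" where
  "thickening Y d \<delta> A = {y \<in> Y. \<exists>a\<in>A. d y a \<le> \<delta>}"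

text \<open>The value 0 off the hyperspace is a convention: the Hausdorff metric only lives on the
  nonempty compact sets, and \<open>Inf {}\<close> is an unspecified real number.\<close>

definition hausdorff_metric ::
    "'a set \<Rightarrow> ('a \<Rightarrow> 'a \<Rightarrow> real) \<Rightarrow> 'a set \<Rightarrow> 'a set \<Rightarrow> real" where
  "hausdorff_metric Y d A B =
     (if A \<in> nonempty_compacts Y d \<and> B \<in> nonempty_compacts Y d
      then Inf {\<delta>. 0 < \<delta> \<and> A \<subseteq> thickening Y d \<delta> B \<and> B \<subseteq> thickening Y d \<delta> A}
      else 0)"

definition product_metric ::
    "nat \<Rightarrow> (nat \<Rightarrow> 'a \<Rightarrow> 'a \<Rightarrow> real) \<Rightarrow> (nat \<Rightarrow> 'a) \<Rightarrow> (nat \<Rightarrow> 'a) \<Rightarrow> real" where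
  "product_metric m d x y = sqrt (\<Sum>k=1..m. (d k (x k) (y k))\<^sup>2)"

definition compact_boxes ::
    "nat \<Rightarrow> (nat \<Rightarrow> 'a set) \<Rightarrow> (nat \<Rightarrow> 'a \<Rightarrow> 'a \<Rightarrow> real) \<Rightarrow> (nat \<Rightarrow> 'a) set set" where
  "compact_boxes m X d =
     {Pi\<^sub>E {1..m} A | A. \<forall>k\<in>{1..m}. A k \<in> nonempty_compacts (X k) (d k)}"

text \<open>The factors of a box are its coordinate projections, as all of them are nonempty; see
  \<open>product_hausdorff_metric_PiE\<close> below.\<close>

definition product_hausdorff_metric ::
    "nat \<Rightarrow> (nat \<Rightarrow> 'a set) \<Rightarrow> (nat \<Rightarrow> 'a \<Rightarrow> 'a \<Rightarrow> real) \<Rightarrow>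
     (nat \<Rightarrow> 'a) set \<Rightarrow> (nat \<Rightarrow> 'a) set \<Rightarrow> real" where
  "product_hausdorff_metric m X d A B =
     sqrt (\<Sum>k=1..m. (hausdorff_metric (X k) (d k) ((\<lambda>x. x k) ` A) ((\<lambda>x. x k) ` B))\<^sup>2)"

lemma product_hausdorff_metric_PiE:
  assumes "\<forall>k\<in>{1..m}. A k \<in> nonempty_compacts (X k) (d k)"
    and "\<forall>k\<in>{1..m}. B k \<in> nonempty_compacts (X k) (d k)"
  shows "product_hausdorff_metric m X d (Pi\<^sub>E {1..m} A) (Pi\<^sub>E {1..m} B) =
         sqrt (\<Sum>k=1..m. (hausdorff_metric (X k) (d k) (A k) (B k))\<^sup>2)"
proof -
  have "(\<lambda>x. x k) ` Pi\<^sub>E {1..m} C = C k"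
    if "\<forall>k\<in>{1..m}. C k \<in> nonempty_compacts (X k) (d k)" "k \<in> {1..m}" for C k
    using that by (auto simp: image_projection_PiE nonempty_compacts_def PiE_eq_empty_iff)
  then show ?thesis
    using assms by (simp add: product_hausdorff_metric_def)
qed

text \<open>Equivalence of metrics in the strong (bi-Lipschitz) sense.\<close>

definition equivalent_metrics ::
    "'a set \<Rightarrow> ('a \<Rightarrow> 'a \<Rightarrow> real) \<Rightarrow> ('a \<Rightarrow> 'a \<Rightarrow> real) \<Rightarrow> bool" where
  "equivalent_metrics S d d' \<longleftrightarrow>
     Metric_space S d \<and> Metric_space S d' \<and>
     (\<exists>c C. 0 < c \<and> 0 < C \<and> (\<forall>x\<in>S. \<forall>y\<in>S. c * d x y \<le> d' x y \<and> d' x y \<le> C * d x y))"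

end

theory Submission
  imports Defs
begin

text \<open>
  The Hausdorff distance of two nonempty compact sets is the least \<open>\<delta> \<ge> 0\<close> such that every point
  of either set has a point of the other one within distance \<open>\<delta>\<close>. Compactness is what makes the
  infimum attained (\<open>hausdorff_metric_le_iff\<close>), and with this both inequalities become statements
  about single points of the boxes \<open>A = \<Prod>\<^sub>k A\<^sub>k\<close> and \<open>B = \<Prod>\<^sub>k B\<^sub>k\<close>.

  For \<open>H A B \<le> H\<^sub>0 A B\<close>, given \<open>x \<in> A\<close>, choose in each factor a point \<open>y\<^sub>k \<in> B\<^sub>k\<close> at distance at
  most \<open>H\<^sub>k A\<^sub>k B\<^sub>k\<close> from \<open>x\<^sub>k\<close>. As \<open>B\<close> is a box, the \<open>y\<^sub>k\<close> fit together to a point of \<open>B\<close>, whose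
  distance from \<open>x\<close> is at most the Euclidean norm of the numbers \<open>H\<^sub>k A\<^sub>k B\<^sub>k\<close>
  (\<open>hausdorff_metric_PiE_le\<close>).

  For the lower bound, each coordinate projection is 1-Lipschitz and maps \<open>A\<close> onto \<open>A\<^sub>k\<close> and \<open>B\<close>
  onto \<open>B\<^sub>k\<close>, so \<open>H\<^sub>k A\<^sub>k B\<^sub>k \<le> H A B\<close> (\<open>hausdorff_metric_factor_le_PiE\<close>). The
  Euclidean norm of \<open>m\<close> numbers that are all at most \<open>H A B\<close> is at most \<open>sqrt m * H A B\<close>.

  That boxes of compact sets are compact for the product metric is Tychonoff's theorem, once the
  product topology is known to be at least as fine as the metric one (\<open>nonempty_compacts_PiE\<close>).
\<close>

section \<open>Pulled back and Lipschitz equivalent metrics\<close>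

lemma Metric_space_inj_pullback:
  assumes "Metric_space M d" and "inj_on f S" and "f ` S \<subseteq> M"
  shows "Metric_space S (\<lambda>x y. d (f x) (f y))"
proof -
  interpret Metric_space M d by fact
  have "f x \<in> M" if "x \<in> S" for x
    using that assms(3) by blast
  then show ?thesis
    using assms(2) by unfold_locales (auto simp: commute triangle inj_on_eq_iff)
qed

lemma openin_mtopology_Lipschitz:
  assumes "Metric_space S d" and "Metric_space S d'" and "0 < C"
    and le: "\<And>x y. x \<in> S \<Longrightarrow> y \<in> S \<Longrightarrow> d' x y \<le> C * d x y"
    and U: "openin (Metric_space.mtopology S d') U"
  shows "openin (Metric_space.mtopology S d) U"
proof -
  interpret m: Metric_space S d by fact
  interpret m': Metric_space S d' by fact
  have "\<exists>r>0. m.mball x r \<subseteq> U" if x: "x \<in> U" for x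
  proof -
    obtain r where r: "r > 0" "m'.mball x r \<subseteq> U"
      using U x m'.openin_mtopology by blast
    have "m.mball x (r / C) \<subseteq> m'.mball x r"
    proof
      fix y assume y: "y \<in> m.mball x (r / C)"
      then have "C * d x y < r"
        using \<open>0 < C\<close> by (simp add: field_simps)
      moreover have "d' x y \<le> C * d x y"
        using y le by simp
      ultimately show "y \<in> m'.mball x r"
        using y by simp
    qed
    then show ?thesis
      using r \<open>0 < C\<close> by (intro exI[of _ "r / C"]) auto
  qed
  then show ?thesis
    using U by (simp add: m'.openin_mtopology m.openin_mtopology)
qed

lemma equivalent_metrics_imp_mtopology_eq:
  assumes "equivalent_metrics S d d'"
  shows "Metric_space.mtopology S d = Metric_space.mtopology S d'"
proof -
  obtain c C where ms: "Metric_space S d" "Metric_space S d'" and pos: "0 < c" "0 < C"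
    and le: "\<And>x y. x \<in> S \<Longrightarrow> y \<in> S \<Longrightarrow> c * d x y \<le> d' x y \<and> d' x y \<le> C * d x y"
    using assms by (auto simp: equivalent_metrics_def)
  have le': "d x y \<le> (1 / c) * d' x y" if "x \<in> S" "y \<in> S" for x y
    using le[OF that] pos by (simp add: field_simps)
  have "openin (Metric_space.mtopology S d) U" if "openin (Metric_space.mtopology S d') U" for U
    using openin_mtopology_Lipschitz[OF ms pos(2) _ that] le by simp
  moreover have "openin (Metric_space.mtopology S d') U" if "openin (Metric_space.mtopology S d) U" for U
    using openin_mtopology_Lipschitz[OF ms(2,1) _ le' that] pos(1) by simp
  ultimately show ?thesis
    unfolding topology_eq by (intro allI iffI)
qed

section \<open>The Hausdorff metric on the nonempty compact sets\<close>

context Metric_space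
begin

lemma nonempty_compacts_subset: "A \<in> nonempty_compacts M d \<Longrightarrow> A \<subseteq> M"
  unfolding nonempty_compacts_def using compactin_subset_topspace by fastforce

lemma compactin_attains_mdist:
  assumes B: "B \<in> nonempty_compacts M d" and a: "a \<in> M"
  obtains b where "b \<in> B" and "\<And>y. y \<in> B \<Longrightarrow> d a b \<le> d a y"
proof -
  have "continuous_map mtopology euclidean (d a)"
    unfolding Met_TC.continuous_map_to_metric[where f = "d a", simplified]
  proof (intro ballI allI impI)
    fix x and e :: real
    assume x: "x \<in> topspace mtopology" and e: "0 < e"
    have "dist (d a x) (d a y) < e" if "y \<in> mball x e" for y
      using mdist_reverse_triangle[of x a y] that a by (simp add: dist_real_def commute)
    then show "\<exists>U. openin mtopology U \<and> x \<in> U \<and> (\<forall>y\<in>U. dist (d a x) (d a y) < e)"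
      using x e by (intro exI[of _ "mball x e"]) auto
  qed
  then have "compact (d a ` B)"
    using B image_compactin by (fastforce simp: nonempty_compacts_def)
  then show ?thesis
    using B that compact_attains_inf[of "d a ` B"] by (auto simp: nonempty_compacts_def)
qed

text \<open>
  Compact sets are bounded, so the infimum in the definition of the Hausdorff metric is not taken
  over the empty set.
\<close>

lemma hausdorff_metric_eq_Inf:
  assumes A: "A \<in> nonempty_compacts M d" and B: "B \<in> nonempty_compacts M d"
  obtains D where "hausdorff_metric M d A B = Inf D" and "D \<noteq> {}"
    and "D = {\<delta>. 0 < \<delta> \<and> (\<forall>a\<in>A. \<exists>b\<in>B. d a b \<le> \<delta>) \<and> (\<forall>b\<in>B. \<exists>a\<in>A. d b a \<le> \<delta>)}"
proof
  let ?D = "{\<delta>. 0 < \<delta> \<and> (\<forall>a\<in>A. \<exists>b\<in>B. d a b \<le> \<delta>) \<and> (\<forall>b\<in>B. \<exists>a\<in>A. d b a \<le> \<delta>)}"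
  have "{\<delta>. 0 < \<delta> \<and> A \<subseteq> thickening M d \<delta> B \<and> B \<subseteq> thickening M d \<delta> A} = ?D"
    using nonempty_compacts_subset[OF A] nonempty_compacts_subset[OF B]
    by (auto simp: thickening_def)
  then show "hausdorff_metric M d A B = Inf ?D"
    using A B by (simp add: hausdorff_metric_def)
  have "mbounded (A \<union> B)"
    using A B compactin_imp_mbounded by (auto simp: nonempty_compacts_def mbounded_Un)
  then obtain C where "C > 0" and C: "\<And>x y. x \<in> A \<union> B \<Longrightarrow> y \<in> A \<union> B \<Longrightarrow> d x y \<le> C"
    unfolding mbounded_alt_pos by blast
  then have "C \<in> ?D"
    using A B by (fastforce simp: nonempty_compacts_def)
  then show "?D \<noteq> {}"
    by blast
qed (rule refl)

text \<open>
  A bound on the infimum only yields points of \<open>B\<close> at distance at most \<open>\<delta> + \<epsilon>\<close> from a given point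
  \<open>a\<close>, for every \<open>\<epsilon> > 0\<close>. A point of \<open>B\<close> nearest to \<open>a\<close> works for all \<open>\<epsilon>\<close> at once, and hence for
  \<open>\<epsilon> = 0\<close>.
\<close>

lemma hausdorff_metric_le_iff:
  assumes A: "A \<in> nonempty_compacts M d" and B: "B \<in> nonempty_compacts M d" and "0 \<le> \<delta>"
  shows "hausdorff_metric M d A B \<le> \<delta> \<longleftrightarrow>
    (\<forall>a\<in>A. \<exists>b\<in>B. d a b \<le> \<delta>) \<and> (\<forall>b\<in>B. \<exists>a\<in>A. d b a \<le> \<delta>)"
proof -
  note sub = nonempty_compacts_subset[OF A] nonempty_compacts_subset[OF B]
  obtain D where h: "hausdorff_metric M d A B = Inf D" and ne: "D \<noteq> {}"
    and D_def: "D = {\<delta>. 0 < \<delta> \<and> (\<forall>a\<in>A. \<exists>b\<in>B. d a b \<le> \<delta>) \<and> (\<forall>b\<in>B. \<exists>a\<in>A. d b a \<le> \<delta>)}"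
    using hausdorff_metric_eq_Inf[OF A B] by blast
  have bdd: "bdd_below D"
    by (rule bdd_belowI[of _ 0]) (auto simp: D_def)
  have approx: "\<exists>b\<in>B'. d a b \<le> \<delta>"
    if B': "B' \<in> nonempty_compacts M d" and a: "a \<in> M"
      and ex: "\<And>\<epsilon>. 0 < \<epsilon> \<Longrightarrow> \<exists>b\<in>B'. d a b \<le> \<delta> + \<epsilon>" for B' a
  proof -
    obtain b where b: "b \<in> B'" "\<And>y. y \<in> B' \<Longrightarrow> d a b \<le> d a y"
      using compactin_attains_mdist[OF B' a] by blast
    have "d a b \<le> \<delta>"
      by (rule field_le_epsilon) (use ex b(2) in \<open>meson order_trans\<close>)
    with b(1) show ?thesis by blast
  qed
  show ?thesis
  proof
    assume le: "hausdorff_metric M d A B \<le> \<delta>"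
    have "(\<forall>a\<in>A. \<exists>b\<in>B. d a b \<le> \<delta> + \<epsilon>) \<and> (\<forall>b\<in>B. \<exists>a\<in>A. d b a \<le> \<delta> + \<epsilon>)"
      if "0 < \<epsilon>" for \<epsilon>
    proof -
      have "Inf D < \<delta> + \<epsilon>"
        using le h that by linarith
      then obtain \<delta>' where "\<delta>' \<in> D" "\<delta>' \<le> \<delta> + \<epsilon>"
        using cInf_lessD[OF ne] less_imp_le by blast
      then show ?thesis
        unfolding D_def by (blast intro: order_trans)
    qed
    note near = this
    show "(\<forall>a\<in>A. \<exists>b\<in>B. d a b \<le> \<delta>) \<and> (\<forall>b\<in>B. \<exists>a\<in>A. d b a \<le> \<delta>)"
    proof (intro conjI ballI)
      show "\<exists>b\<in>B. d a b \<le> \<delta>" if "a \<in> A" for a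
        using that sub near by (intro approx B) auto
      show "\<exists>a\<in>A. d b a \<le> \<delta>" if "b \<in> B" for b
        using that sub near by (intro approx A) auto
    qed
  next
    assume R: "(\<forall>a\<in>A. \<exists>b\<in>B. d a b \<le> \<delta>) \<and> (\<forall>b\<in>B. \<exists>a\<in>A. d b a \<le> \<delta>)"
    \<comment> \<open>The set \<open>D\<close> has only positive elements, so \<open>\<delta>\<close> itself need not belong to it.\<close>
    have "\<delta> + \<epsilon> \<in> D" if "0 < \<epsilon>" for \<epsilon>
    proof -
      have "\<delta> \<le> \<delta> + \<epsilon>" "0 < \<delta> + \<epsilon>"
        using that \<open>0 \<le> \<delta>\<close> by auto
      then show ?thesis
        using R unfolding D_def by (blast intro: order_trans)
    qed
    then show "hausdorff_metric M d A B \<le> \<delta>"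
      unfolding h using cInf_lower[OF _ bdd] field_le_epsilon by metis
  qed
qed

lemma hausdorff_metric_nonneg: "0 \<le> hausdorff_metric M d A B"
proof (cases "A \<in> nonempty_compacts M d \<and> B \<in> nonempty_compacts M d")
  case True
  then have A: "A \<in> nonempty_compacts M d" and B: "B \<in> nonempty_compacts M d"
    by auto
  obtain D where h: "hausdorff_metric M d A B = Inf D" and ne: "D \<noteq> {}"
    and D_def: "D = {\<delta>. 0 < \<delta> \<and> (\<forall>a\<in>A. \<exists>b\<in>B. d a b \<le> \<delta>) \<and> (\<forall>b\<in>B. \<exists>a\<in>A. d b a \<le> \<delta>)}"
    using hausdorff_metric_eq_Inf[OF A B] by blast
  have "\<And>\<delta>. \<delta> \<in> D \<Longrightarrow> 0 \<le> \<delta>"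
    by (simp add: D_def)
  then show ?thesis
    unfolding h using ne by (intro cInf_greatest)
qed (auto simp: hausdorff_metric_def)

lemma hausdorff_metric_commute: "hausdorff_metric M d A B = hausdorff_metric M d B A"
  by (auto simp: hausdorff_metric_def conj_commute intro!: arg_cong[where f = Inf])

lemma hausdorff_metric_near_point:
  assumes "A \<in> nonempty_compacts M d" and "B \<in> nonempty_compacts M d" and "a \<in> A"
  shows "\<exists>b\<in>B. d a b \<le> hausdorff_metric M d A B"
  using hausdorff_metric_le_iff[OF assms(1,2) hausdorff_metric_nonneg[of A B]] assms(3) by auto

lemma hausdorff_metric_leI:
  assumes "A \<in> nonempty_compacts M d" and "B \<in> nonempty_compacts M d" and "0 \<le> \<delta>"
    and "\<And>a. a \<in> A \<Longrightarrow> \<exists>b\<in>B. d a b \<le> \<delta>" and "\<And>b. b \<in> B \<Longrightarrow> \<exists>a\<in>A. d b a \<le> \<delta>"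
  shows "hausdorff_metric M d A B \<le> \<delta>"
  using assms by (simp add: hausdorff_metric_le_iff)

lemma hausdorff_metric_eq_0_iff:
  assumes A: "A \<in> nonempty_compacts M d" and B: "B \<in> nonempty_compacts M d"
  shows "hausdorff_metric M d A B = 0 \<longleftrightarrow> A = B"
proof -
  have eq: "d x y \<le> 0 \<longleftrightarrow> x = y" if "x \<in> A \<union> B" "y \<in> A \<union> B" for x y
  proof -
    have "x \<in> M" "y \<in> M"
      using that nonempty_compacts_subset[OF A] nonempty_compacts_subset[OF B] by auto
    then show ?thesis
      using nonneg[of x y] zero[of x y] by linarith
  qed
  have "hausdorff_metric M d A B = 0 \<longleftrightarrow> hausdorff_metric M d A B \<le> 0"
    using hausdorff_metric_nonneg[of A B] by linarith
  also have "\<dots> \<longleftrightarrow> (\<forall>a\<in>A. \<exists>b\<in>B. a = b) \<and> (\<forall>b\<in>B. \<exists>a\<in>A. b = a)"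
    by (simp add: hausdorff_metric_le_iff[OF A B] eq cong: ball_cong bex_cong)
  also have "\<dots> \<longleftrightarrow> A = B"
    by blast
  finally show ?thesis .
qed

lemma hausdorff_metric_triangle:
  assumes A: "A \<in> nonempty_compacts M d" and B: "B \<in> nonempty_compacts M d"
    and C: "C \<in> nonempty_compacts M d"
  shows "hausdorff_metric M d A C \<le> hausdorff_metric M d A B + hausdorff_metric M d B C"
proof -
  have step: "\<exists>z\<in>R. d x z \<le> hausdorff_metric M d P Q + hausdorff_metric M d Q R"
    if P: "P \<in> nonempty_compacts M d" and Q: "Q \<in> nonempty_compacts M d"
      and R: "R \<in> nonempty_compacts M d" and x: "x \<in> P" for P Q R x
  proof -
    obtain y where y: "y \<in> Q" "d x y \<le> hausdorff_metric M d P Q"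
      using hausdorff_metric_near_point[OF P Q x] by blast
    obtain z where z: "z \<in> R" "d y z \<le> hausdorff_metric M d Q R"
      using hausdorff_metric_near_point[OF Q R y(1)] by blast
    have "d x z \<le> d x y + d y z"
      using x y z nonempty_compacts_subset P Q R by (intro triangle) blast+
    with y z show ?thesis
      by (intro bexI[of _ z]) auto
  qed
  show ?thesis
  proof (rule hausdorff_metric_leI[OF A C])
    show "0 \<le> hausdorff_metric M d A B + hausdorff_metric M d B C"
      by (simp add: hausdorff_metric_nonneg)
    show "\<exists>z\<in>C. d x z \<le> hausdorff_metric M d A B + hausdorff_metric M d B C" if "x \<in> A" for x
      using step[OF A B C that] .
    show "\<exists>z\<in>A. d x z \<le> hausdorff_metric M d A B + hausdorff_metric M d B C" if "x \<in> C" for x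
      using step[OF C B A that]
      by (simp add: hausdorff_metric_commute[of C B] hausdorff_metric_commute[of B A] add.commute)
  qed
qed

lemma Metric_space_hausdorff_metric:
  "Metric_space (nonempty_compacts M d) (hausdorff_metric M d)"
  by (rule Metric_space.intro)
    (fact hausdorff_metric_nonneg hausdorff_metric_commute
      hausdorff_metric_eq_0_iff hausdorff_metric_triangle)+

end

section \<open>The product metric\<close>

lemma product_metric_L2_set:
  "product_metric m d x y = L2_set (\<lambda>k. d k (x k) (y k)) {1..m}"
  by (simp add: product_metric_def L2_set_def)

lemma Metric_space_product_metric:
  assumes "\<forall>k\<in>{1..m}. Metric_space (X k) (d k)"
  shows "Metric_space (Pi\<^sub>E {1..m} X) (product_metric m d)"
proof
  fix x y
  show "0 \<le> product_metric m d x y"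
    by (simp add: product_metric_L2_set)
  show "product_metric m d x y = product_metric m d y x"
    unfolding product_metric_L2_set using assms
    by (intro L2_set_cong) (auto intro: Metric_space.commute)
  assume xy: "x \<in> Pi\<^sub>E {1..m} X" "y \<in> Pi\<^sub>E {1..m} X"
  have "product_metric m d x y = 0 \<longleftrightarrow> (\<forall>k\<in>{1..m}. x k = y k)"
  proof -
    have "d k (x k) (y k) = 0 \<longleftrightarrow> x k = y k" if "k \<in> {1..m}" for k
      using Metric_space.zero[OF bspec[OF assms that]] PiE_mem[OF xy(1) that] PiE_mem[OF xy(2) that]
      by simp
    then show ?thesis
      by (simp add: product_metric_L2_set L2_set_eq_0_iff)
  qed
  then show "product_metric m d x y = 0 \<longleftrightarrow> x = y"
    using PiE_ext[OF xy] by auto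
  fix z assume z: "z \<in> Pi\<^sub>E {1..m} X"
  have "d k (x k) (z k) \<le> d k (x k) (y k) + d k (y k) (z k)" if "k \<in> {1..m}" for k
    by (rule Metric_space.triangle[OF bspec[OF assms that]
          PiE_mem[OF xy(1) that] PiE_mem[OF xy(2) that] PiE_mem[OF z that]])
  then have "product_metric m d x z \<le> L2_set (\<lambda>k. d k (x k) (y k) + d k (y k) (z k)) {1..m}"
    unfolding product_metric_L2_set using assms
    by (intro L2_set_mono) (auto intro: Metric_space.nonneg)
  also have "\<dots> \<le> product_metric m d x y + product_metric m d y z"
    unfolding product_metric_L2_set by (rule L2_set_triangle_ineq)
  finally show "product_metric m d x z \<le> product_metric m d x y + product_metric m d y z" .
qed

text \<open>
  The identity is continuous from the product topology because the Euclidean norm is at most the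
  sum of the coordinates: a box of balls of radius \<open>\<epsilon> / (m + 1)\<close> lies in a ball of radius \<open>\<epsilon>\<close>.
  Tychonoff's theorem then transfers to the product metric.
\<close>

lemma nonempty_compacts_PiE:
  assumes ms: "\<forall>k\<in>{1..m}. Metric_space (X k) (d k)"
    and A: "\<forall>k\<in>{1..m}. A k \<in> nonempty_compacts (X k) (d k)"
  shows "Pi\<^sub>E {1..m} A \<in> nonempty_compacts (Pi\<^sub>E {1..m} X) (product_metric m d)"
proof -
  define T where "T = product_topology (\<lambda>k. Metric_space.mtopology (X k) (d k)) {1..m}"
  interpret P: Metric_space "Pi\<^sub>E {1..m} X" "product_metric m d"
    using ms by (rule Metric_space_product_metric)
  have topT: "topspace T = Pi\<^sub>E {1..m} X"
    unfolding T_def topspace_product_topology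
    by (rule PiE_cong) (use ms in \<open>simp add: Metric_space.topspace_mtopology\<close>)
  have "continuous_map T P.mtopology (\<lambda>x. x)"
    unfolding P.continuous_map_to_metric
  proof (intro ballI allI impI)
    fix x and \<epsilon> :: real
    assume x: "x \<in> topspace T" and \<epsilon>: "0 < \<epsilon>"
    \<comment> \<open>The divisor is \<open>m + 1\<close> so that the radius is positive and the sum of the \<open>m\<close> coordinate
      distances stays strictly below \<open>\<epsilon>\<close> also for the empty product.\<close>
    define r where "r = \<epsilon> / (real m + 1)"
    have r: "0 < r" "real m * r < \<epsilon>"
      using \<epsilon> by (simp_all add: r_def field_simps)
    define U where "U = (\<Pi>\<^sub>E k\<in>{1..m}. Metric_space.mball (X k) (d k) (x k) r)"
    have xX: "x k \<in> X k" if "k \<in> {1..m}" for k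
      using x that by (auto simp: topT)
    have "openin T U"
      unfolding T_def U_def using ms
      by (subst openin_PiE) (auto intro: Metric_space.openin_mball)
    moreover have "x \<in> U"
      using x xX r ms unfolding U_def topT
      by (auto simp: PiE_iff Metric_space.centre_in_mball_iff)
    moreover have "y \<in> P.mball x \<epsilon>" if y: "y \<in> U" for y
    proof -
      have yk: "y k \<in> X k \<and> d k (x k) (y k) < r" if "k \<in> {1..m}" for k
        using PiE_mem[OF y[unfolded U_def] that]
        by (simp only: Metric_space.in_mball[OF bspec[OF ms that]])
      have "product_metric m d x y \<le> (\<Sum>k\<in>{1..m}. d k (x k) (y k))"
        unfolding product_metric_L2_set using ms
        by (intro L2_set_le_sum) (auto intro: Metric_space.nonneg)
      also have "\<dots> \<le> real m * r"
        using sum_bounded_above[of "{1..m}" "\<lambda>k. d k (x k) (y k)" r] yk by fastforce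
      finally have "product_metric m d x y < \<epsilon>"
        using r by simp
      moreover have "y \<in> Pi\<^sub>E {1..m} X"
        using y yk by (auto simp: U_def PiE_iff)
      ultimately show ?thesis
        using x unfolding P.in_mball topT by blast
    qed
    ultimately show "\<exists>U. openin T U \<and> x \<in> U \<and> (\<forall>y\<in>U. y \<in> P.mball x \<epsilon>)"
      by blast
  qed
  moreover have "compactin T (Pi\<^sub>E {1..m} A)"
    using A unfolding T_def compactin_PiE by (auto simp: nonempty_compacts_def)
  ultimately have "compactin P.mtopology (Pi\<^sub>E {1..m} A)"
    using image_compactin by fastforce
  then show ?thesis
    using A by (auto simp: nonempty_compacts_def PiE_eq_empty_iff)
qed

section \<open>Comparison of the two metrics on boxes\<close>

text \<open>
  Extensional families of compact sets correspond to boxes: a box is determined by its coordinate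
  projections. This identifies the product Hausdorff metric with the product metric of the
  Hausdorff metrics of the factors.
\<close>

lemma Metric_space_product_hausdorff_metric:
  fixes X :: "nat \<Rightarrow> 'a set"
  assumes ms: "\<forall>k\<in>{1..m}. Metric_space (X k) (d k)"
  shows "Metric_space (compact_boxes m X d) (product_hausdorff_metric m X d)"
proof -
  define K where "K = (\<lambda>k. nonempty_compacts (X k) (d k))"
  define p where "p = (\<lambda>A :: (nat \<Rightarrow> 'a) set. \<lambda>k\<in>{1..m}. (\<lambda>x. x k) ` A)"
  have p_PiE: "p (Pi\<^sub>E {1..m} A) = restrict A {1..m}" if "\<forall>k\<in>{1..m}. A k \<in> K k" for A
    using that
    by (auto simp: p_def K_def image_projection_PiE nonempty_compacts_def PiE_eq_empty_iff
        intro!: restrict_ext)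
  have p: "Pi\<^sub>E {1..m} (p A) = A" "p A \<in> Pi\<^sub>E {1..m} K" if A: "A \<in> compact_boxes m X d" for A
  proof -
    obtain B where B: "\<forall>k\<in>{1..m}. B k \<in> K k" "A = Pi\<^sub>E {1..m} B"
      using A unfolding compact_boxes_def K_def by blast
    show "p A \<in> Pi\<^sub>E {1..m} K"
      unfolding B(2) p_PiE[OF B(1)] using B(1) by auto
    show "Pi\<^sub>E {1..m} (p A) = A"
      unfolding B(2) p_PiE[OF B(1)] by (rule PiE_cong) simp
  qed
  have inj: "inj_on p (compact_boxes m X d)"
    by (rule inj_on_inverseI) (rule p(1))
  have image: "p ` compact_boxes m X d \<subseteq> Pi\<^sub>E {1..m} K"
    using p(2) by (rule image_subsetI)
  have K: "Metric_space (Pi\<^sub>E {1..m} K) (product_metric m (\<lambda>k. hausdorff_metric (X k) (d k)))"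
    unfolding K_def using ms
    by (intro Metric_space_product_metric ballI Metric_space.Metric_space_hausdorff_metric) blast
  have "product_hausdorff_metric m X d =
      (\<lambda>A B. product_metric m (\<lambda>k. hausdorff_metric (X k) (d k)) (p A) (p B))"
    by (simp add: fun_eq_iff product_hausdorff_metric_def product_metric_def p_def)
  then show ?thesis
    using Metric_space_inj_pullback[OF K inj image] by simp
qed

lemma product_hausdorff_metric_PiE_L2_set:
  assumes "\<forall>k\<in>{1..m}. A k \<in> nonempty_compacts (X k) (d k)"
    and "\<forall>k\<in>{1..m}. B k \<in> nonempty_compacts (X k) (d k)"
  shows "product_hausdorff_metric m X d (Pi\<^sub>E {1..m} A) (Pi\<^sub>E {1..m} B) =
    L2_set (\<lambda>k. hausdorff_metric (X k) (d k) (A k) (B k)) {1..m}"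
  unfolding product_hausdorff_metric_PiE[OF assms] L2_set_def ..

lemma hausdorff_metric_PiE_le:
  assumes ms: "\<forall>k\<in>{1..m}. Metric_space (X k) (d k)"
    and A: "\<forall>k\<in>{1..m}. A k \<in> nonempty_compacts (X k) (d k)"
    and B: "\<forall>k\<in>{1..m}. B k \<in> nonempty_compacts (X k) (d k)"
  shows "hausdorff_metric (Pi\<^sub>E {1..m} X) (product_metric m d) (Pi\<^sub>E {1..m} A) (Pi\<^sub>E {1..m} B)
    \<le> product_hausdorff_metric m X d (Pi\<^sub>E {1..m} A) (Pi\<^sub>E {1..m} B)"
proof -
  interpret P: Metric_space "Pi\<^sub>E {1..m} X" "product_metric m d"
    using ms by (rule Metric_space_product_metric)
  have near: "\<exists>y\<in>Pi\<^sub>E {1..m} B'. product_metric m d x y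
      \<le> L2_set (\<lambda>k. hausdorff_metric (X k) (d k) (A' k) (B' k)) {1..m}"
    if A': "\<forall>k\<in>{1..m}. A' k \<in> nonempty_compacts (X k) (d k)"
      and B': "\<forall>k\<in>{1..m}. B' k \<in> nonempty_compacts (X k) (d k)"
      and x: "x \<in> Pi\<^sub>E {1..m} A'" for A' B' x
  proof -
    have "\<forall>k\<in>{1..m}. \<exists>b\<in>B' k. d k (x k) b \<le> hausdorff_metric (X k) (d k) (A' k) (B' k)"
      using ms A' B' PiE_mem[OF x] by (blast intro: Metric_space.hausdorff_metric_near_point)
    then obtain y where
      y: "\<And>k. k \<in> {1..m} \<Longrightarrow>
        y k \<in> B' k \<and> d k (x k) (y k) \<le> hausdorff_metric (X k) (d k) (A' k) (B' k)"
      by metis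
    have "product_metric m d x (restrict y {1..m})
        \<le> L2_set (\<lambda>k. hausdorff_metric (X k) (d k) (A' k) (B' k)) {1..m}"
      unfolding product_metric_L2_set using y ms
      by (intro L2_set_mono) (auto intro: Metric_space.nonneg)
    then show ?thesis
      using y by (intro bexI[of _ "restrict y {1..m}"]) auto
  qed
  have comm: "L2_set (\<lambda>k. hausdorff_metric (X k) (d k) (B k) (A k)) {1..m}
      = L2_set (\<lambda>k. hausdorff_metric (X k) (d k) (A k) (B k)) {1..m}"
    using ms by (intro L2_set_cong) (auto intro: Metric_space.hausdorff_metric_commute)
  show ?thesis
    unfolding product_hausdorff_metric_PiE_L2_set[OF A B]
    by (rule P.hausdorff_metric_leI[OF nonempty_compacts_PiE[OF ms A]
            nonempty_compacts_PiE[OF ms B] L2_set_nonneg])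
      (fact near[OF A B] near[OF B A, unfolded comm])+
qed

text \<open>
  A point of \<open>A k\<close> is a coordinate of some point of the box, because the other factors are nonempty;
  the coordinate of a nearby point of the second box is then at least as near.
\<close>

lemma hausdorff_metric_factor_le_PiE:
  assumes ms: "\<forall>k\<in>{1..m}. Metric_space (X k) (d k)"
    and A: "\<forall>k\<in>{1..m}. A k \<in> nonempty_compacts (X k) (d k)"
    and B: "\<forall>k\<in>{1..m}. B k \<in> nonempty_compacts (X k) (d k)"
    and k: "k \<in> {1..m}"
  shows "hausdorff_metric (X k) (d k) (A k) (B k)
    \<le> hausdorff_metric (Pi\<^sub>E {1..m} X) (product_metric m d) (Pi\<^sub>E {1..m} A) (Pi\<^sub>E {1..m} B)"
proof -
  let ?H = "hausdorff_metric (Pi\<^sub>E {1..m} X) (product_metric m d)"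
  interpret P: Metric_space "Pi\<^sub>E {1..m} X" "product_metric m d"
    using ms by (rule Metric_space_product_metric)
  interpret Xk: Metric_space "X k" "d k"
    using bspec[OF ms k] .
  have near: "\<exists>b\<in>B' k. d k a b \<le> ?H (Pi\<^sub>E {1..m} A') (Pi\<^sub>E {1..m} B')"
    if A': "\<forall>k\<in>{1..m}. A' k \<in> nonempty_compacts (X k) (d k)"
      and B': "\<forall>k\<in>{1..m}. B' k \<in> nonempty_compacts (X k) (d k)"
      and a: "a \<in> A' k" for A' B' a
  proof -
    have "(\<lambda>x. x k) ` Pi\<^sub>E {1..m} A' = A' k"
      using A' k by (auto simp: image_projection_PiE nonempty_compacts_def PiE_eq_empty_iff)
    with a have "a \<in> (\<lambda>x. x k) ` Pi\<^sub>E {1..m} A'"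
      by simp
    then obtain x where x: "x \<in> Pi\<^sub>E {1..m} A'" "x k = a"
      by (metis imageE)
    obtain y where y: "y \<in> Pi\<^sub>E {1..m} B'"
      "product_metric m d x y \<le> ?H (Pi\<^sub>E {1..m} A') (Pi\<^sub>E {1..m} B')"
      using P.hausdorff_metric_near_point[OF nonempty_compacts_PiE[OF ms A']
          nonempty_compacts_PiE[OF ms B'] x(1)] by blast
    have "d k (x k) (y k) \<le> product_metric m d x y"
      unfolding product_metric_L2_set using k
      by (intro member_le_L2_set[where f = "\<lambda>k. d k (x k) (y k)"]) auto
    then show ?thesis
      using x y k by (intro bexI[of _ "y k"]) auto
  qed
  show ?thesis
    by (rule Xk.hausdorff_metric_leI[OF bspec[OF A k] bspec[OF B k] P.hausdorff_metric_nonneg])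
      (fact near[OF A B] near[OF B A, unfolded P.hausdorff_metric_commute[of "Pi\<^sub>E {1..m} B"]])+
qed

lemma product_hausdorff_metric_PiE_le:
  assumes ms: "\<forall>k\<in>{1..m}. Metric_space (X k) (d k)"
    and A: "\<forall>k\<in>{1..m}. A k \<in> nonempty_compacts (X k) (d k)"
    and B: "\<forall>k\<in>{1..m}. B k \<in> nonempty_compacts (X k) (d k)"
  shows "product_hausdorff_metric m X d (Pi\<^sub>E {1..m} A) (Pi\<^sub>E {1..m} B) \<le> sqrt (real m) *
    hausdorff_metric (Pi\<^sub>E {1..m} X) (product_metric m d) (Pi\<^sub>E {1..m} A) (Pi\<^sub>E {1..m} B)"
    (is "_ \<le> _ * ?h")
proof -
  interpret P: Metric_space "Pi\<^sub>E {1..m} X" "product_metric m d"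
    using ms by (rule Metric_space_product_metric)
  have "product_hausdorff_metric m X d (Pi\<^sub>E {1..m} A) (Pi\<^sub>E {1..m} B)
      \<le> L2_set (\<lambda>k. ?h) {1..m}"
    unfolding product_hausdorff_metric_PiE_L2_set[OF A B]
    by (intro L2_set_mono hausdorff_metric_factor_le_PiE[OF ms A B])
      (assumption | rule Metric_space.hausdorff_metric_nonneg[OF bspec[OF ms]])+
  also have "\<dots> = sqrt (real m) * ?h"
    unfolding L2_set_constant abs_of_nonneg[OF P.hausdorff_metric_nonneg] by simp
  finally show ?thesis .
qed

theorem theorem3p1:
  fixes m :: nat
    and X :: "nat \<Rightarrow> 'a set"
    and d :: "nat \<Rightarrow> 'a \<Rightarrow> 'a \<Rightarrow> real"
  assumes "1 \<le> m"
    and "\<forall>k\<in>{1..m}. Metric_space (X k) (d k) \<and> Metric_space.mcomplete (X k) (d k)"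
  defines "H \<equiv> hausdorff_metric (Pi\<^sub>E {1..m} X) (product_metric m d)"
    and "H\<^sub>0 \<equiv> product_hausdorff_metric m X d"
    and "HH \<equiv> compact_boxes m X d"
  shows "HH \<subseteq> nonempty_compacts (Pi\<^sub>E {1..m} X) (product_metric m d)
    \<and> equivalent_metrics HH H\<^sub>0 H
    \<and> Metric_space.mtopology HH H\<^sub>0 = Metric_space.mtopology HH H
    \<and> (\<forall>A\<in>HH. \<forall>B\<in>HH. 1 / sqrt (real m) * H\<^sub>0 A B \<le> H A B \<and> H A B \<le> H\<^sub>0 A B)"
proof -
  have ms: "\<forall>k\<in>{1..m}. Metric_space (X k) (d k)"
    using assms(2) by blast
  have sub: "HH \<subseteq> nonempty_compacts (Pi\<^sub>E {1..m} X) (product_metric m d)"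
    unfolding HH_def compact_boxes_def using nonempty_compacts_PiE[OF ms] by blast
  have m: "0 < sqrt (real m)"
    using assms(1) by simp
  have le: "1 / sqrt (real m) * H\<^sub>0 A B \<le> H A B \<and> H A B \<le> H\<^sub>0 A B"
    if "A \<in> HH" "B \<in> HH" for A B
  proof -
    have "H\<^sub>0 A B \<le> sqrt (real m) * H A B" "H A B \<le> H\<^sub>0 A B"
      using that product_hausdorff_metric_PiE_le[OF ms] hausdorff_metric_PiE_le[OF ms]
      unfolding HH_def compact_boxes_def H_def H\<^sub>0_def by blast+
    then show ?thesis
      using m by (simp add: field_simps)
  qed
  have "Metric_space HH H\<^sub>0"
    unfolding HH_def H\<^sub>0_def using ms by (rule Metric_space_product_hausdorff_metric)
  moreover have "Metric_space HH H"
    unfolding H_def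
    using Metric_space.subspace[OF Metric_space.Metric_space_hausdorff_metric sub]
      Metric_space_product_metric[OF ms] by blast
  moreover have "\<exists>c C. 0 < c \<and> 0 < C \<and>
      (\<forall>A\<in>HH. \<forall>B\<in>HH. c * H\<^sub>0 A B \<le> H A B \<and> H A B \<le> C * H\<^sub>0 A B)"
    using le m by (intro exI[of _ "1 / sqrt (real m)"] exI[of _ 1]) simp
  ultimately have "equivalent_metrics HH H\<^sub>0 H"
    unfolding equivalent_metrics_def by blast
  then show ?thesis
    using sub le equivalent_metrics_imp_mtopology_eq by blast
qed

end
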